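(* For every integer $n\ge 1$, \[\overline{p}(3n)\equiv (-1)^n\, r_5(n) \pmod 9.\]
   Context: An overpartition of a nonnegative integer $n$ is a partition of $n$ in which the first occurrence of each distinct part may (or may not) be overlined; $\overline{p}(n)$ denotes the number of overpartitions of $n$ (with $\overline{p}(0)=1$). Equivalently, $\sum_{n\ge0}\overline{p}(n)q^n=\prod_{k\ge1}\frac{1+q^k}{1-q^k}=1/\varphi(-q)$, where $\varphi(q)=\sum_{n=-\infty}^{\infty}q^{n^2}$. For an integer $k\ge1$, $r_k(n)$ denotes the number of $(x_1,\dots,x_k)\in\mathbb{Z}^k$ with $x_1^2+\cdots+x_k^2=n$. *)

theory Defs
  imports Main "HOL-Library.Multiset"
begin

text \<open>An overpartition of n: a partition of n (a multiset of positive parts summing to n)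
  together with the set of distinct parts whose first occurrence is overlined.\<close>
definition overpartitions :: "nat \<Rightarrow> (nat multiset \<times> nat set) set" where
  "overpartitions n = {(P, S). (\<forall>x\<in>#P. 0 < x) \<and> sum_mset P = n \<and> S \<subseteq> set_mset P}"

definition overpartition_count :: "nat \<Rightarrow> nat" where
  "overpartition_count n = card (overpartitions n)"

definition r_sq :: "nat \<Rightarrow> nat \<Rightarrow> nat" where
  "r_sq k n = card {xs :: int list. length xs = k \<and> (\<Sum>x\<leftarrow>xs. x^2) = int n}"

end

theory Submission
  imports Defs Complex_Main "HOL-Computational_Algebra.Formal_Power_Series"
begin

text \<open>
  Put F(q) = \<phi>(-q) and G = 1/F, the generating function of overpartitions. From the infinite
  product for G, the product of G over q, \<omega>q, \<omega>^2q (with \<omega> a primitive cube root of unity)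
  equals G(q^3)^4 / G(q^9). Squares are never 2 modulo 3, so F = a + b with a = F(q^9) and b
  supported on exponents congruent to 1; the product of the two conjugates of F is then
  a^2 - ab + b^2, of which only a^2 contributes to exponents divisible by 3. Hence the
  overpartition numbers at 3n have generating function G(q)^4 F(q^3)^3. Since
  F(q^3) is congruent to F(q)^3 modulo 3, its cube is congruent to F(q)^9 modulo 9, which
  leaves F(q)^5.
\<close>

unbundle fps_syntax

section \<open>Counting overpartitions\<close>

text \<open>Bounding the parts turns the infinite product for the generating function into finite
  partial products, which are accessible by induction on \<open>N\<close>.\<close>

definition bounded_overpartitions :: "nat \<Rightarrow> nat \<Rightarrow> (nat multiset \<times> nat set) set" where
  "bounded_overpartitions N n = {(P, S) \<in> overpartitions n. \<forall>x\<in>#P. x \<le> N}"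

lemma bounded_overpartitions_0:
  "bounded_overpartitions 0 n = (if n = 0 then {({#}, {})} else {})"
proof -
  have "P = {#}" if "\<forall>x\<in>#P. 0 < x" "\<forall>x\<in>#P. x \<le> 0" for P :: "nat multiset"
    using that by (cases P) auto
  then have "bounded_overpartitions 0 n = {(P, S). P = {#} \<and> S = {} \<and> n = 0}"
    by (fastforce simp: bounded_overpartitions_def overpartitions_def)
  then show ?thesis by auto
qed

lemma bounded_overpartitions_Suc_less:
  assumes "n < Suc N"
  shows "bounded_overpartitions (Suc N) n = bounded_overpartitions N n"
proof -
  have "x \<le> N" if "x \<in># P" "sum_mset P = n" for x P
    using that assms by (auto dest!: multi_member_split)
  then show ?thesis
    unfolding bounded_overpartitions_def overpartitions_def using le_SucI by blast
qed

text \<open>If \<open>Suc N\<close> occurs, one copy of it is removed. Either the overlined set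
  still consists of remaining parts, or the removed copy was the only one and was overlined; in the
  latter case all remaining parts are at most \<open>N\<close>.\<close>

lemma bounded_overpartitions_Suc_ge:
  assumes "n \<ge> Suc N"
  shows "bounded_overpartitions (Suc N) n =
    bounded_overpartitions N n \<union>
    (\<lambda>(P, S). (add_mset (Suc N) P, S)) ` bounded_overpartitions (Suc N) (n - Suc N) \<union>
    (\<lambda>(P, S). (add_mset (Suc N) P, insert (Suc N) S)) ` bounded_overpartitions N (n - Suc N)"
    (is "?A = ?B \<union> ?C \<union> ?D")
proof
  show "?A \<subseteq> ?B \<union> ?C \<union> ?D"
  proof
    fix z assume "z \<in> ?A"
    then obtain P S where z: "z = (P, S)" and P: "\<forall>x\<in>#P. 0 < x" "sum_mset P = n"
      "S \<subseteq> set_mset P" "\<forall>x\<in>#P. x \<le> Suc N"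
      by (auto simp: bounded_overpartitions_def overpartitions_def)
    show "z \<in> ?B \<union> ?C \<union> ?D"
    proof (cases "Suc N \<in># P")
      case False
      then have "\<forall>x\<in>#P. x \<le> N"
        using P(4) by (metis le_Suc_eq)
      then show ?thesis
        using P z by (auto simp: bounded_overpartitions_def overpartitions_def)
    next
      case True
      then obtain P' where P': "P = add_mset (Suc N) P'"
        by (auto dest!: multi_member_split)
      show ?thesis
      proof (cases "S \<subseteq> set_mset P'")
        case True
        then have "(P', S) \<in> bounded_overpartitions (Suc N) (n - Suc N)"
          using P P' by (auto simp: bounded_overpartitions_def overpartitions_def)
        then show ?thesis using z P' by force
      next
        case False
        then have S: "Suc N \<in> S" "Suc N \<notin># P'"
          using P(3) P' by auto
        then have "\<forall>x\<in>#P'. x \<le> N"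
          using P(4) P' by (metis le_Suc_eq insert_iff set_mset_add_mset_insert)
        then have "(P', S - {Suc N}) \<in> bounded_overpartitions N (n - Suc N)"
          using P P' by (auto simp: bounded_overpartitions_def overpartitions_def)
        moreover have "z = (add_mset (Suc N) P', insert (Suc N) (S - {Suc N}))"
          using z P' S by auto
        ultimately show ?thesis by force
      qed
    qed
  qed
  show "?B \<union> ?C \<union> ?D \<subseteq> ?A"
    using assms by (fastforce simp: bounded_overpartitions_def overpartitions_def)
qed

text \<open>The recursion for \<open>Suc N\<close> refers to \<open>Suc N\<close> again at a smaller
  sum, hence a strong induction on \<open>n\<close> inside the induction on
  \<open>N\<close>.\<close>

lemma finite_bounded_overpartitions: "finite (bounded_overpartitions N n)"
proof (induction N arbitrary: n)
  case 0
  then show ?case by (simp add: bounded_overpartitions_0)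
next
  case (Suc N)
  show ?case
  proof (induction n rule: less_induct)
    case (less n)
    show ?case
    proof (cases "n < Suc N")
      case True
      then show ?thesis
        using Suc bounded_overpartitions_Suc_less by simp
    next
      case False
      then have "n \<ge> Suc N" "n - Suc N < n" by auto
      then show ?thesis
        using Suc less by (subst bounded_overpartitions_Suc_ge) auto
    qed
  qed
qed

lemma card_bounded_overpartitions_Suc_ge:
  assumes "n \<ge> Suc N"
  shows "card (bounded_overpartitions (Suc N) n) = card (bounded_overpartitions N n) +
    card (bounded_overpartitions (Suc N) (n - Suc N)) + card (bounded_overpartitions N (n - Suc N))"
proof -
  let ?B = "bounded_overpartitions N n"
  let ?C = "(\<lambda>(P, S). (add_mset (Suc N) P, S)) ` bounded_overpartitions (Suc N) (n - Suc N)"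
  let ?D = "(\<lambda>(P, S). (add_mset (Suc N) P, insert (Suc N) S)) ` bounded_overpartitions N (n - Suc N)"
  \<comment> \<open>This separates the three pieces, and it allows \<open>S\<close> to be recovered
    from \<open>insert (Suc N) S\<close> when the third map is shown to be injective.\<close>
  have notin: "Suc N \<notin># P \<and> Suc N \<notin> S" if "(P, S) \<in> bounded_overpartitions N m" for P S m
    using that by (fastforce simp: bounded_overpartitions_def overpartitions_def)
  have "?B \<inter> ?C = {}" "(?B \<union> ?C) \<inter> ?D = {}"
    using notin by (fastforce simp: bounded_overpartitions_def overpartitions_def)+
  then have "card (?B \<union> ?C \<union> ?D) = card ?B + card ?C + card ?D"
    by (simp add: card_Un_disjoint finite_bounded_overpartitions)
  moreover have "card ?C = card (bounded_overpartitions (Suc N) (n - Suc N))"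
    by (intro card_image inj_onI) auto
  moreover have "card ?D = card (bounded_overpartitions N (n - Suc N))"
  proof (intro card_image inj_onI)
    fix u v assume u: "u \<in> bounded_overpartitions N (n - Suc N)"
      and v: "v \<in> bounded_overpartitions N (n - Suc N)"
      and eq: "(\<lambda>(P, S). (add_mset (Suc N) P, insert (Suc N) S)) u =
        (\<lambda>(P, S). (add_mset (Suc N) P, insert (Suc N) S)) v"
    obtain P S P' S' where uv: "u = (P, S)" "v = (P', S')"
      by (cases u, cases v)
    show "u = v"
      using eq notin[of P S] notin[of P' S'] u v unfolding uv by (auto dest: insert_ident)
  qed
  ultimately show ?thesis
    using bounded_overpartitions_Suc_ge[OF assms] by simp
qed

lemma overpartition_count_eq_card_bounded:
  assumes "n \<le> N"
  shows "overpartition_count n = card (bounded_overpartitions N n)"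
proof -
  have "x \<le> N" if "x \<in># P" "sum_mset P = n" for x P
    using that assms by (auto dest!: multi_member_split)
  then have "overpartitions n = bounded_overpartitions N n"
    by (auto simp: bounded_overpartitions_def overpartitions_def)
  then show ?thesis
    by (simp add: overpartition_count_def)
qed

section \<open>Generating functions with bounded and unbounded parts\<close>

definition bounded_overpartition_fps :: "nat \<Rightarrow> int fps" where
  "bounded_overpartition_fps N = Abs_fps (\<lambda>n. int (card (bounded_overpartitions N n)))"

definition overpartition_fps :: "int fps" where
  "overpartition_fps = Abs_fps (\<lambda>n. int (overpartition_count n))"

lemma bounded_overpartition_fps_0: "bounded_overpartition_fps 0 = 1"
  by (rule fps_ext) (simp add: bounded_overpartition_fps_def bounded_overpartitions_0)

text \<open>The recursion for the counts, read as the factor (1 + q^k) / (1 - q^k) for k =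
  \<open>Suc N\<close> with its denominator cleared.\<close>

lemma bounded_overpartition_fps_Suc:
  "bounded_overpartition_fps (Suc N) * (1 - fps_X ^ Suc N) =
   bounded_overpartition_fps N * (1 + fps_X ^ Suc N)"
proof (rule fps_ext)
  fix n
  show "(bounded_overpartition_fps (Suc N) * (1 - fps_X ^ Suc N)) $ n =
      (bounded_overpartition_fps N * (1 + fps_X ^ Suc N)) $ n"
    unfolding right_diff_distrib distrib_left fps_sub_nth fps_add_nth mult_1_right
      fps_X_power_mult_right_nth
    using card_bounded_overpartitions_Suc_ge[of N n] bounded_overpartitions_Suc_less[of n N]
    by (cases "n < Suc N") (simp_all add: bounded_overpartition_fps_def del: power_Suc)
qed

section \<open>Gauss's identity\<close>

text \<open>Coefficients of phi(-q): for n = x^2 the signs (-1)^n and (-1)^x agree. Having the sign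
  depend on \<open>n\<close> alone makes powers of the series easy to read off.\<close>

definition theta_coeff :: "nat \<Rightarrow> int" where
  "theta_coeff n = (-1) ^ n * int (card {x :: int. x\<^sup>2 = int n})"

definition theta_fps :: "int fps" where
  "theta_fps = Abs_fps theta_coeff"

lemma theta_coeff_0: "theta_coeff 0 = 1"
  by (simp add: theta_coeff_def)

lemma theta_coeff_square: "m > 0 \<Longrightarrow> theta_coeff (m\<^sup>2) = 2 * (-1) ^ m"
proof -
  assume "m > 0"
  have "{x :: int. x\<^sup>2 = int (m\<^sup>2)} = {int m, - int m}"
    by (auto simp: power2_eq_iff)
  moreover have "(-1 :: int) ^ m\<^sup>2 = (-1) ^ m"
    by (simp add: minus_one_power_iff)
  ultimately show ?thesis
    using \<open>m > 0\<close> by (simp add: theta_coeff_def)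
qed

lemma theta_coeff_nonsquare: "(\<And>m. n \<noteq> m\<^sup>2) \<Longrightarrow> theta_coeff n = 0"
proof -
  assume *: "\<And>m. n \<noteq> m\<^sup>2"
  have "x\<^sup>2 \<noteq> int n" for x :: int
  proof
    assume "x\<^sup>2 = int n"
    then have "int ((nat \<bar>x\<bar>)\<^sup>2) = int n" by simp
    then show False using * by (metis of_nat_eq_iff)
  qed
  then show ?thesis by (simp add: theta_coeff_def)
qed

definition theta_partial :: "nat \<Rightarrow> int fps" where
  "theta_partial n = 1 + (\<Sum>j=1..n. 2 * (-1) ^ j * fps_X ^ (j\<^sup>2))"

text \<open>Since m <= m^2, every square up to \<open>n\<close> has its root among the summation
  indices, so the truncation loses nothing up to exponent \<open>n\<close>.\<close>

lemma theta_partial_nth: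
  assumes "i \<le> n"
  shows "theta_partial n $ i = theta_fps $ i"
proof -
  have nth: "theta_partial n $ i =
      (if i = 0 then 1 else 0) + (\<Sum>j=1..n. if i = j\<^sup>2 then 2 * (-1) ^ j else 0)"
  proof -
    have "(2 * (-1) ^ j * fps_X ^ (j\<^sup>2) :: int fps) $ i = (if i = j\<^sup>2 then 2 * (-1) ^ j else 0)" for j
    proof -
      have "(2 * (-1) ^ j :: int fps) = fps_const (2 * (-1) ^ j)"
        by (simp add: fps_numeral_fps_const flip: fps_const_power fps_const_mult fps_const_neg)
      then show ?thesis
        by (simp only: fps_mult_left_const_nth fps_X_power_nth) simp
    qed
    then show ?thesis
      by (simp only: theta_partial_def fps_add_nth fps_sum_nth fps_one_nth)
  qed
  consider "i = 0" | m where "m > 0" "i = m\<^sup>2" | "\<forall>m. i \<noteq> m\<^sup>2"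
    by (cases "\<exists>m. i = m\<^sup>2") (auto, metis not_gr0 zero_power2)
  then show ?thesis
  proof cases
    case 1
    then show ?thesis unfolding nth by (simp add: theta_fps_def theta_coeff_0)
  next
    case 2
    have "m \<le> m\<^sup>2" by (simp add: power2_eq_square)
    then have "m \<in> {1..n}" using 2 assms by auto
    have "(\<Sum>j=1..n. if i = j\<^sup>2 then 2 * (-1) ^ j else 0) =
        (\<Sum>j=1..n. if j = m then 2 * (-1) ^ m else (0::int))"
      by (rule sum.cong) (auto simp: 2)
    also have "\<dots> = 2 * (-1) ^ m"
      using \<open>m \<in> {1..n}\<close> by simp
    finally show ?thesis
      unfolding nth using 2 by (simp add: theta_fps_def theta_coeff_square)
  next
    case 3
    then have "i \<noteq> 0" by (metis zero_power2)
    then show ?thesis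
      unfolding nth using 3 by (simp add: theta_fps_def theta_coeff_nonsquare)
  qed
qed

text \<open>
  A finite form of Gauss's identity in the manner of Shanks. All terms of the sum have exponent
  larger than n, so letting n grow gives theta times the overpartition series equal to 1.
\<close>
lemma theta_partial_mult_bounded_overpartition_fps:
  "theta_partial n * bounded_overpartition_fps n =
   1 + (\<Sum>s=1..n. (-1) ^ s * (bounded_overpartition_fps s + bounded_overpartition_fps (s - 1)) *
          fps_X ^ (s * Suc n))"
proof (induction n)
  case 0
  then show ?case by (simp add: theta_partial_def bounded_overpartition_fps_0)
next
  case (Suc m)
  define n where "n = Suc m"
  define Q where "Q = bounded_overpartition_fps"
  define Y :: "int fps" where "Y = fps_X ^ n"
  \<comment> \<open>The signed monomial (-1)^n q^(n^2); the theta sum gains twice this term when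
    \<open>m\<close> is replaced by \<open>n\<close>.\<close>
  define e :: "int fps" where "e = (-1) ^ n * Y ^ n"
  \<comment> \<open>Both sides are expressed through \<open>H\<close>: the induction hypothesis as
    \<open>H * (1 - Y) - e * Q m\<close>, the goal as \<open>H * (1 + Y) + e * Q n\<close>. The
    recursion \<open>Q\<close> then links the two.\<close>
  define H where "H = (\<Sum>s=0..m. (-1) ^ s * Q s * Y ^ s)"
  have Q: "Q n * (1 - Y) = Q m * (1 + Y)"
    using bounded_overpartition_fps_Suc[of m] by (simp add: n_def Q_def Y_def)
  have shift: "(\<Sum>s=1..k. (-1) ^ s * Q (s - 1) * Y ^ s) = - Y * (\<Sum>s<k. (-1) ^ s * Q s * Y ^ s)" for k
    by (induction k) (auto simp: algebra_simps)
  have unshift: "(\<Sum>s=1..k. (-1) ^ s * Q s * Y ^ s) = (\<Sum>s=0..k. (-1) ^ s * Q s * Y ^ s) - 1" for k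
    by (induction k) (auto simp: Q_def bounded_overpartition_fps_0)
  have H': "(\<Sum>s<m. (-1) ^ s * Q s * Y ^ s) = H - (-1) ^ m * Q m * Y ^ m"
    by (simp add: H_def atLeast0AtMost lessThan_Suc_atMost[symmetric])
  have eY: "Y * ((-1) ^ m * Q m * Y ^ m) = - e * Q m"
    by (simp add: e_def n_def algebra_simps)
  have IH: "theta_partial m * Q m = H * (1 - Y) - e * Q m"
  proof -
    have "theta_partial m * Q m = 1 + (\<Sum>s=1..m. (-1) ^ s * Q s * Y ^ s) +
        (\<Sum>s=1..m. (-1) ^ s * Q (s - 1) * Y ^ s)"
    proof -
      have "(-1) ^ s * (Q s + Q (s - 1)) * fps_X ^ (s * Suc m) =
          (-1) ^ s * Q s * Y ^ s + (-1) ^ s * Q (s - 1) * Y ^ s" for s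
        unfolding Y_def n_def power_mult[symmetric] mult.commute[of "Suc m"]
        by (simp only: distrib_left distrib_right)
      then show ?thesis
        using Suc unfolding Q_def[symmetric] by (simp only: sum.distrib add.assoc)
    qed
    also have "\<dots> = H + - Y * (H - (-1) ^ m * Q m * Y ^ m)"
      unfolding shift unshift H' H_def[symmetric] by simp
    also have "\<dots> = H * (1 - Y) - e * Q m"
      using eY by (simp add: algebra_simps)
    finally show ?thesis .
  qed
  have S: "theta_partial n = theta_partial m + 2 * e"
    by (simp add: theta_partial_def n_def e_def Y_def power_mult[symmetric] power2_eq_square
        del: mult_Suc mult_Suc_right power_Suc)
  have R: "1 + (\<Sum>s=1..n. (-1) ^ s * (Q s + Q (s - 1)) * fps_X ^ (s * Suc n)) =
      H * (1 + Y) + e * Q n"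
  proof -
    \<comment> \<open>The product recursion trades the sum of neighbours for their difference and
      lowers the exponent from s(n+1) to sn, the exponent that occurs in the induction
      hypothesis.\<close>
    have step: "(Q s + Q (s - 1)) * fps_X ^ (s * Suc n) = (Q s - Q (s - 1)) * Y ^ s"
      if "s \<in> {1..n}" for s
    proof -
      have "Q s * (1 - fps_X ^ s) = Q (s - 1) * (1 + fps_X ^ s)"
        using bounded_overpartition_fps_Suc[of "s - 1"] that by (simp add: Q_def del: power_Suc)
      then have "(Q s + Q (s - 1)) * fps_X ^ s = Q s - Q (s - 1)"
        by (simp add: algebra_simps)
      moreover have "fps_X ^ (s * Suc n) = fps_X ^ s * Y ^ s"
        by (simp add: Y_def power_mult[symmetric] power_add[symmetric] algebra_simps)
      ultimately show ?thesis by (simp add: mult.assoc[symmetric])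
    qed
    have "(\<Sum>s=1..n. (-1) ^ s * (Q s + Q (s - 1)) * fps_X ^ (s * Suc n)) =
        (\<Sum>s=1..n. (-1) ^ s * Q s * Y ^ s - (-1) ^ s * Q (s - 1) * Y ^ s)"
      by (rule sum.cong) (use step in \<open>simp_all add: mult.assoc left_diff_distrib right_diff_distrib\<close>)
    also have "\<dots> = (H + e * Q n - 1) + Y * H"
      unfolding sum_subtractf shift unshift
      by (simp add: n_def lessThan_Suc_atMost atLeast0AtMost H_def e_def algebra_simps)
    finally show ?thesis by (simp add: algebra_simps)
  qed
  \<comment> \<open>The recursion is available only in multiplied form, so the identity is proved
    after multiplication by \<open>1 - Y\<close>, which is then cancelled; \<open>n > 0\<close>
    makes its constant term 1.\<close>
  have "1 - Y \<noteq> 0"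
  proof
    assume "1 - Y = 0"
    then have "(1 - Y) $ 0 = 0" by simp
    then show False by (simp add: Y_def n_def)
  qed
  moreover have "(1 - Y) * (theta_partial n * Q n) = (1 - Y) * (H * (1 + Y) + e * Q n)"
  proof -
    have "(1 - Y) * (theta_partial n * Q n) = (theta_partial m * Q m + 2 * e * Q m) * (1 + Y)"
    proof -
      have "(1 - Y) * (theta_partial n * Q n) = theta_partial n * (Q n * (1 - Y))"
        by (simp only: ac_simps)
      also have "\<dots> = (theta_partial m * Q m + 2 * e * Q m) * (1 + Y)"
        unfolding Q S by (simp add: algebra_simps)
      finally show ?thesis .
    qed
    also have "\<dots> = (1 - Y) * (H * (1 + Y)) + e * (Q m * (1 + Y))"
      unfolding IH by (simp add: algebra_simps)
    also have "\<dots> = (1 - Y) * (H * (1 + Y) + e * Q n)"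
      unfolding Q[symmetric] by (simp add: algebra_simps)
    finally show ?thesis .
  qed
  ultimately have "theta_partial n * Q n = H * (1 + Y) + e * Q n"
    by simp
  then show ?case
    using R by (simp only: n_def Q_def)
qed

lemma fps_mult_nth_cong:
  assumes "\<And>i. i \<le> n \<Longrightarrow> f $ i = f' $ i" "\<And>i. i \<le> n \<Longrightarrow> g $ i = g' $ i"
  shows "(f * g) $ n = (f' * g') $ n"
  using assms by (simp add: fps_mult_nth)

lemma overpartition_fps_nth:
  "i \<le> N \<Longrightarrow> overpartition_fps $ i = bounded_overpartition_fps N $ i"
  by (simp add: overpartition_fps_def bounded_overpartition_fps_def
      overpartition_count_eq_card_bounded)

text \<open>Coefficient \<open>n\<close> of a product sees only coefficients up to \<open>n\<close>
  of its factors, so both series may be replaced by their finite versions at level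
  \<open>n\<close>.\<close>

lemma theta_fps_mult_overpartition_fps: "theta_fps * overpartition_fps = 1"
proof (rule fps_ext)
  fix n
  have "(theta_fps * overpartition_fps) $ n = (theta_partial n * bounded_overpartition_fps n) $ n"
    by (rule fps_mult_nth_cong) (simp_all add: theta_partial_nth overpartition_fps_nth)
  also have "\<dots> = (1 :: int fps) $ n"
  proof -
    have "((-1) ^ s * (bounded_overpartition_fps s + bounded_overpartition_fps (s - 1)) *
          fps_X ^ (s * Suc n)) $ n = 0" if "s \<in> {1..n}" for s
    proof -
      have "n < s * Suc n" using that by (cases s) auto
      then show ?thesis by (simp add: fps_X_power_mult_right_nth)
    qed
    then show ?thesis
      by (simp add: theta_partial_mult_bounded_overpartition_fps fps_sum_nth del: mult_Suc_right)
  qed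
  finally show "(theta_fps * overpartition_fps) $ n = 1 $ n" .
qed

section \<open>Sums of squares\<close>

lemma finite_square_roots: "finite {x :: int. x\<^sup>2 = int i}"
proof (rule finite_subset)
  show "{x :: int. x\<^sup>2 = int i} \<subseteq> {- int i..int i}"
  proof
    fix x :: int assume "x \<in> {x. x\<^sup>2 = int i}"
    then have "\<bar>x\<bar> * \<bar>x\<bar> = int i" by (simp add: power2_eq_square)
    moreover have "\<bar>x\<bar> \<le> \<bar>x\<bar> * \<bar>x\<bar>"
      by (cases "x = 0") (simp_all add: mult_le_cancel_left1 del: abs_mult_self_eq)
    ultimately show "x \<in> {- int i..int i}" by auto
  qed
qed simp

definition square_tuples :: "nat \<Rightarrow> nat \<Rightarrow> int list set" where
  "square_tuples k n = {xs. length xs = k \<and> (\<Sum>x\<leftarrow>xs. x\<^sup>2) = int n}"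

text \<open>Sorting tuples by the square \<open>i\<close> of the first entry prepares the
  convolution that matches the Cauchy product of power series.\<close>

lemma square_tuples_Suc:
  "square_tuples (Suc k) n =
    (\<Union>i\<le>n. (\<lambda>(x, xs). x # xs) ` ({x. x\<^sup>2 = int i} \<times> square_tuples k (n - i)))"
proof
  show "square_tuples (Suc k) n \<subseteq>
    (\<Union>i\<le>n. (\<lambda>(x, xs). x # xs) ` ({x. x\<^sup>2 = int i} \<times> square_tuples k (n - i)))"
  proof
    fix ys assume "ys \<in> square_tuples (Suc k) n"
    then obtain x xs where ys: "ys = x # xs" "length xs = k" "x\<^sup>2 + (\<Sum>y\<leftarrow>xs. y\<^sup>2) = int n"
      by (cases ys) (auto simp: square_tuples_def)
    have "(\<Sum>y\<leftarrow>xs. y\<^sup>2) \<ge> 0" by (rule sum_list_nonneg) auto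
    then have "nat (x\<^sup>2) \<le> n" "(\<Sum>y\<leftarrow>xs. y\<^sup>2) = int (n - nat (x\<^sup>2))"
      using ys(3) zero_le_power2[of x] by (auto simp: of_nat_diff)
    then have "nat (x\<^sup>2) \<le> n \<and> (x, xs) \<in> {y. y\<^sup>2 = int (nat (x\<^sup>2))} \<times> square_tuples k (n - nat (x\<^sup>2))"
      using ys by (simp add: square_tuples_def)
    then show "ys \<in> (\<Union>i\<le>n. (\<lambda>(x, xs). x # xs) ` ({x. x\<^sup>2 = int i} \<times> square_tuples k (n - i)))"
      using ys(1) by blast
  qed
qed (auto simp: square_tuples_def of_nat_diff)

lemma finite_square_tuples: "finite (square_tuples k n)"
proof (induction k arbitrary: n)
  case 0
  have "square_tuples 0 n \<subseteq> {[]}" by (auto simp: square_tuples_def)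
  then show ?case by (rule finite_subset) simp
next
  case (Suc k)
  then show ?case
    by (simp add: square_tuples_Suc finite_square_roots)
qed

lemma card_square_tuples_Suc:
  "card (square_tuples (Suc k) n) =
    (\<Sum>i\<le>n. card {x :: int. x\<^sup>2 = int i} * card (square_tuples k (n - i)))"
proof -
  have "card (square_tuples (Suc k) n) =
      (\<Sum>i\<le>n. card ((\<lambda>(x, xs). x # xs) ` ({x :: int. x\<^sup>2 = int i} \<times> square_tuples k (n - i))))"
    unfolding square_tuples_Suc
    by (rule card_UN_disjoint) (auto simp: finite_square_roots finite_square_tuples)
  also have "\<dots> = (\<Sum>i\<le>n. card ({x :: int. x\<^sup>2 = int i} \<times> square_tuples k (n - i)))"
    by (intro sum.cong refl card_image inj_onI) auto
  finally show ?thesis by (simp add: card_cartesian_product)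
qed

text \<open>In the Cauchy product the signs of indices \<open>i\<close> and \<open>n - i\<close>
  multiply to (-1)^n, so the sign factors out of the count. With k = 5 this is the right-hand side
  of the congruence.\<close>

lemma theta_fps_power_nth: "(theta_fps ^ k) $ n = (-1) ^ n * int (r_sq k n)"
proof -
  have "(theta_fps ^ k) $ n = (-1) ^ n * int (card (square_tuples k n))"
  proof (induction k arbitrary: n)
    case 0
    have "square_tuples 0 n = (if n = 0 then {[]} else {})"
      by (auto simp: square_tuples_def)
    then show ?case by simp
  next
    case (Suc k)
    have "(theta_fps ^ Suc k) $ n = (\<Sum>i\<le>n. theta_coeff i *
        ((-1) ^ (n - i) * int (card (square_tuples k (n - i)))))"
      by (simp add: fps_mult_nth Suc atLeast0AtMost) (simp add: theta_fps_def)
    also have "\<dots> = (\<Sum>i\<le>n. (-1) ^ n *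
        (int (card {x :: int. x\<^sup>2 = int i}) * int (card (square_tuples k (n - i)))))"
    proof (rule sum.cong)
      fix i assume "i \<in> {..n}"
      then have "(-1) ^ n = (-1) ^ i * (-1 :: int) ^ (n - i)"
        by (simp flip: power_add)
      then show "theta_coeff i * ((-1) ^ (n - i) * int (card (square_tuples k (n - i)))) =
          (-1) ^ n * (int (card {x :: int. x\<^sup>2 = int i}) * int (card (square_tuples k (n - i))))"
        by (simp add: theta_coeff_def)
    qed simp
    finally show ?case
      by (simp add: card_square_tuples_Suc sum_distrib_left)
  qed
  then show ?thesis by (simp add: r_sq_def square_tuples_def)
qed

section \<open>Trisection of the generating function\<close>

lemma fps_compose_X_power_nth:
  fixes f :: "'a :: comm_ring_1 fps"
  assumes "k > 0"
  shows "(f oo fps_X ^ k) $ n = (if k dvd n then f $ (n div k) else 0)"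
proof -
  have "(f oo fps_X ^ k) $ n = (\<Sum>i=0..n. if n = k * i then f $ i else 0)"
    by (simp add: fps_compose_nth power_mult[symmetric] if_distrib cong: if_cong)
  also have "\<dots> = (if k dvd n then f $ (n div k) else 0)"
  proof (cases "k dvd n")
    case True
    then have "(\<Sum>i=0..n. if n = k * i then f $ i else 0) =
        (\<Sum>i=0..n. if i = n div k then f $ i else 0)"
      using assms by (intro sum.cong) auto
    then show ?thesis using True by simp
  next
    case False
    then show ?thesis by (auto intro!: sum.neutral)
  qed
  finally show ?thesis .
qed

lemma fps_compose_X_power_X_power:
  fixes f :: "'a :: idom fps"
  assumes "j > 0" "k > 0"
  shows "(f oo fps_X ^ j) oo fps_X ^ k = f oo fps_X ^ (j * k)"
proof -
  have "(f oo fps_X ^ j) oo fps_X ^ k = f oo (fps_X ^ j oo fps_X ^ k)"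
    by (rule fps_compose_assoc[symmetric]) (use assms in auto)
  then show ?thesis
    using assms by (simp add: fps_X_power_compose power_mult[symmetric] mult.commute)
qed

definition trisection :: "'a :: comm_ring_1 fps \<Rightarrow> 'a fps" where
  "trisection f = Abs_fps (\<lambda>n. f $ (3 * n))"

lemma trisection_nth: "trisection f $ n = f $ (3 * n)"
  by (simp add: trisection_def)

text \<open>A series in q^3 contributes only indices divisible by 3, which forces the index in
  \<open>f\<close> to be divisible by 3 as well.\<close>

lemma trisection_mult:
  fixes f g :: "'a :: comm_ring_1 fps"
  shows "trisection ((g oo fps_X ^ 3) * f) = g * trisection f"
proof (rule fps_ext)
  fix n
  have "((g oo fps_X ^ 3) * f) $ (3 * n) = (\<Sum>i=0..3 * n. (g oo fps_X ^ 3) $ i * f $ (3 * n - i))"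
    by (simp add: fps_mult_nth)
  also have "\<dots> = (\<Sum>i\<in>(\<lambda>j. 3 * j) ` {0..n}. (g oo fps_X ^ 3) $ i * f $ (3 * n - i))"
  proof (rule sum.mono_neutral_right)
    show "\<forall>i\<in>{0..3 * n} - (\<lambda>j. 3 * j) ` {0..n}. (g oo fps_X ^ 3) $ i * f $ (3 * n - i) = 0"
    proof
      fix i assume i: "i \<in> {0..3 * n} - (\<lambda>j. 3 * j) ` {0..n}"
      have "\<not> 3 dvd i"
      proof
        assume "3 dvd i"
        then obtain j where "i = 3 * j" ..
        then show False using i by auto
      qed
      then show "(g oo fps_X ^ 3) $ i * f $ (3 * n - i) = 0"
        by (simp add: fps_compose_X_power_nth)
    qed
  qed auto
  also have "\<dots> = (\<Sum>j=0..n. g $ j * f $ (3 * (n - j)))"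
    by (subst sum.reindex) (auto simp: inj_on_def fps_compose_X_power_nth right_diff_distrib')
  finally show "trisection ((g oo fps_X ^ 3) * f) $ n = (g * trisection f) $ n"
    by (simp add: trisection_nth fps_mult_nth)
qed

text \<open>Cube roots of unity require complex coefficients; this embedding is injective, so
  identities transfer back to the integers.\<close>

definition complex_fps :: "int fps \<Rightarrow> complex fps" where
  "complex_fps f = Abs_fps (\<lambda>n. of_int (f $ n))"

lemma complex_fps_nth [simp]: "complex_fps f $ n = of_int (f $ n)"
  by (simp add: complex_fps_def)

lemma complex_fps_eq_iff: "complex_fps f = complex_fps g \<longleftrightarrow> f = g"
  by (simp add: fps_eq_iff)

lemma complex_fps_1: "complex_fps 1 = 1"
  by (rule fps_ext) simp

lemma complex_fps_mult: "complex_fps (f * g) = complex_fps f * complex_fps g"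
  by (rule fps_ext) (simp add: fps_mult_nth)

lemma complex_fps_power: "complex_fps (f ^ k) = complex_fps f ^ k"
  by (induction k) (simp_all add: complex_fps_1 complex_fps_mult)

lemma complex_fps_compose_X_power:
  "k > 0 \<Longrightarrow> complex_fps (f oo fps_X ^ k) = complex_fps f oo fps_X ^ k"
  by (rule fps_ext) (simp add: fps_compose_X_power_nth)

lemma complex_fps_trisection: "complex_fps (trisection f) = trisection (complex_fps f)"
  by (rule fps_ext) (simp add: trisection_nth)

section \<open>A primitive cube root of unity\<close>

definition \<omega> :: complex where
  "\<omega> = Complex (- 1 / 2) (sqrt 3 / 2)"

lemma omega_square: "\<omega>\<^sup>2 = - 1 - \<omega>"
  by (simp add: \<omega>_def complex_eq_iff power2_eq_square field_simps)

lemma omega_cube: "\<omega> ^ 3 = 1"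
proof -
  have "\<omega> ^ 3 = \<omega> * \<omega>\<^sup>2" by (simp add: power3_eq_cube power2_eq_square)
  also have "\<dots> = - \<omega> - \<omega>\<^sup>2"
    by (subst omega_square) (simp add: algebra_simps power2_eq_square)
  also have "\<dots> = 1" by (simp add: omega_square)
  finally show ?thesis .
qed

lemma omega_sum: "\<omega> + \<omega>\<^sup>2 = - 1"
  by (simp add: omega_square)

lemma omega_prod: "\<omega> * \<omega>\<^sup>2 = 1"
  using omega_cube by (simp add: power2_eq_square power3_eq_cube mult.assoc)

lemma omega_power_mod: "\<omega> ^ n = \<omega> ^ (n mod 3)"
proof -
  have "\<omega> ^ n = \<omega> ^ (3 * (n div 3) + n mod 3)" by simp
  then show ?thesis by (simp only: power_add power_mult omega_cube) simp
qed

section \<open>The substitution q to cq and the norm over the cube roots of unity\<close>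

definition twist :: "complex \<Rightarrow> complex fps \<Rightarrow> complex fps" where
  "twist c f = f oo (fps_const c * fps_X)"

lemma twist_nth: "twist c f $ n = c ^ n * f $ n"
  by (simp add: twist_def)

lemma twist_mult: "twist c (f * g) = twist c f * twist c g"
  by (simp add: twist_def fps_compose_mult_distrib)

lemma twist_1: "twist c 1 = 1"
  by (simp add: twist_def)

text \<open>The product of f(q), f(wq) and f(w^2 q) for w = \<open>\<omega>\<close>, the norm of
  \<open>f\<close> over the series in q^3.\<close>

definition cubic_norm :: "complex fps \<Rightarrow> complex fps" where
  "cubic_norm f = f * twist \<omega> f * twist (\<omega>\<^sup>2) f"

lemma cubic_norm_mult: "cubic_norm (f * g) = cubic_norm f * cubic_norm g"
  by (simp add: cubic_norm_def twist_mult)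

lemma cubic_norm_1: "cubic_norm 1 = 1"
  by (simp add: cubic_norm_def twist_1)

lemma twist_binomial:
  "twist w (1 + fps_const c * fps_X ^ k) = 1 + fps_const (c * w ^ k) * fps_X ^ k"
  by (rule fps_ext) (simp add: twist_nth)

text \<open>For k divisible by 3 the three factors coincide. Otherwise the powers of the cube roots
  permute them, and the product collapses to 1 + c^3 q^(3k). The hypothesis covers c = 1 and c = -1,
  the numerators and denominators of the overpartition product.\<close>

lemma cubic_norm_binomial:
  assumes "c ^ 3 = c"
  shows "cubic_norm (1 + fps_const c * fps_X ^ k) =
    (if 3 dvd k then (1 + fps_const c * fps_X ^ k) ^ 3 else 1 + fps_const c * fps_X ^ (3 * k))"
proof (cases "3 dvd k")
  case True
  then have w: "\<omega> ^ k = 1" "(\<omega>\<^sup>2) ^ k = 1"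
    using omega_power_mod[of k] omega_power_mod[of "2 * k"]
    by (simp_all add: power_mult[symmetric] mod_eq_0_iff_dvd)
  then show ?thesis
    using True by (simp add: cubic_norm_def twist_binomial power3_eq_cube)
next
  case False
  define a b d where "a = c" and "b = c * \<omega> ^ k" and "d = c * (\<omega>\<^sup>2) ^ k"
  define Y :: "complex fps" where "Y = fps_X ^ k"
  have "k mod 3 = 1 \<or> k mod 3 = 2"
    using False by presburger
  then have w: "\<omega> ^ k = \<omega> \<and> (\<omega>\<^sup>2) ^ k = \<omega>\<^sup>2 \<or> \<omega> ^ k = \<omega>\<^sup>2 \<and> (\<omega>\<^sup>2) ^ k = \<omega>"
  proof
    assume k: "k mod 3 = 1"
    then have "(2 * k) mod 3 = 2" by presburger
    then show ?thesis
      using omega_power_mod[of k] omega_power_mod[of "2 * k"] k by (simp add: power_mult[symmetric])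
  next
    assume k: "k mod 3 = 2"
    then have "(2 * k) mod 3 = 1" by presburger
    then show ?thesis
      using omega_power_mod[of k] omega_power_mod[of "2 * k"] k by (simp add: power_mult[symmetric])
  qed
  then have ws: "\<omega> ^ k + (\<omega>\<^sup>2) ^ k = - 1" and wp: "\<omega> ^ k * (\<omega>\<^sup>2) ^ k = 1"
    using omega_sum omega_prod by (auto simp: add.commute mult.commute)
  have s: "b + d = - c" "b * d = c\<^sup>2"
  proof -
    have "b + d = c * (\<omega> ^ k + (\<omega>\<^sup>2) ^ k)" "b * d = c\<^sup>2 * (\<omega> ^ k * (\<omega>\<^sup>2) ^ k)"
      unfolding b_def d_def by (simp_all only: distrib_left power2_eq_square ac_simps)
    then show "b + d = - c" "b * d = c\<^sup>2"
      unfolding ws wp by simp_all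
  qed
  \<comment> \<open>The elementary symmetric functions of c, cw and cw^2: the first two vanish and
    the third is c^3 = c.\<close>
  have e: "a + (b + d) = 0" "a * (b + d) + b * d = 0" "a * (b * d) = c"
    unfolding s using assms by (simp_all add: a_def power2_eq_square power3_eq_cube)
  have "(1 + fps_const a * Y) * (1 + fps_const b * Y) * (1 + fps_const d * Y) =
      1 + fps_const (a + (b + d)) * Y + fps_const (a * (b + d) + b * d) * Y\<^sup>2 +
      fps_const (a * (b * d)) * Y ^ 3"
    by (simp add: algebra_simps power2_eq_square power3_eq_cube
        flip: fps_const_add fps_const_mult)
  also have "\<dots> = 1 + fps_const c * Y ^ 3"
    unfolding e by simp
  finally show ?thesis
    using False
    by (simp add: cubic_norm_def twist_binomial a_def b_def d_def Y_def power_mult[symmetric]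
        mult.commute)
qed

section \<open>Norms of the finite products\<close>

definition binomial_prod :: "complex \<Rightarrow> nat \<Rightarrow> complex fps" where
  "binomial_prod c N = (\<Prod>k=1..N. 1 + fps_const c * fps_X ^ k)"

lemma binomial_prod_Suc:
  "binomial_prod c (Suc N) = binomial_prod c N * (1 + fps_const c * fps_X ^ Suc N)"
  by (simp add: binomial_prod_def del: power_Suc)

lemma binomial_prod_nth_0: "binomial_prod c N $ 0 = 1"
  by (induction N) (simp_all add: binomial_prod_Suc, simp add: binomial_prod_def)

lemma binomial_compose_X_power:
  "j > 0 \<Longrightarrow> (1 + fps_const c * fps_X ^ k) oo fps_X ^ j =
    1 + fps_const (c :: complex) * fps_X ^ (j * k)"
  by (simp add: fps_compose_add_distrib fps_compose_mult_distrib fps_X_power_compose power_mult)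

text \<open>Up to 3M the multiples of 3 are 3, ..., 3M, and their norms give the cube. The other k
  give factors 1 + c q^(3k): the full product in q^3 with the multiples of 3 removed. Those removed
  factors form the product in q^9, kept on the left to avoid division.\<close>

lemma cubic_norm_binomial_prod:
  assumes "c ^ 3 = c"
  shows "cubic_norm (binomial_prod c (3 * M)) * (binomial_prod c M oo fps_X ^ 9) =
    (binomial_prod c (3 * M) oo fps_X ^ 3) * (binomial_prod c M oo fps_X ^ 3) ^ 3"
proof (induction M)
  case 0
  then show ?case by (simp add: binomial_prod_def cubic_norm_1)
next
  case (Suc M)
  define t where "t k = 1 + fps_const c * (fps_X :: complex fps) ^ k" for k
  have comp: "t k oo fps_X ^ j = t (j * k)" if "j > 0" for j k
    unfolding t_def using that by (rule binomial_compose_X_power)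
  have step: "binomial_prod c (Suc N) = binomial_prod c N * t (Suc N)" for N
    unfolding t_def by (rule binomial_prod_Suc)
  \<comment> \<open>Raising \<open>M\<close> by one adds three factors, one for each residue modulo
    3.\<close>
  have three: "binomial_prod c (3 * Suc M) =
      binomial_prod c (3 * M) * (t (3 * M + 1) * t (3 * M + 2) * t (3 * M + 3))"
    using step[of "3 * M"] step[of "3 * M + 1"] step[of "3 * M + 2"]
    by (simp add: mult.assoc numeral_3_eq_3)
  have dvd: "\<not> 3 dvd 3 * M + 1" "\<not> 3 dvd 3 * M + 2" "3 dvd 3 * M + 3"
    by presburger+
  have n1: "cubic_norm (t (3 * M + 1)) = t (3 * (3 * M + 1))"
    and n2: "cubic_norm (t (3 * M + 2)) = t (3 * (3 * M + 2))"
    and n3: "cubic_norm (t (3 * M + 3)) = t (3 * M + 3) ^ 3"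
    unfolding t_def cubic_norm_binomial[OF assms] by (simp_all only: dvd if_True if_False)
  have "cubic_norm (binomial_prod c (3 * Suc M)) * (binomial_prod c (Suc M) oo fps_X ^ 9) =
      (cubic_norm (binomial_prod c (3 * M)) * (binomial_prod c M oo fps_X ^ 9)) *
      (t (3 * (3 * M + 1)) * t (3 * (3 * M + 2)) * t (9 * Suc M) * t (3 * Suc M) ^ 3)"
    unfolding three step cubic_norm_mult n1 n2 n3
    by (simp add: fps_compose_mult_distrib comp algebra_simps)
  also have "\<dots> = (binomial_prod c (3 * Suc M) oo fps_X ^ 3) * (binomial_prod c (Suc M) oo fps_X ^ 3) ^ 3"
    unfolding Suc three step
    by (simp add: fps_compose_mult_distrib comp algebra_simps power_mult_distrib)
  finally show ?case .
qed

lemma bounded_overpartition_fps_mult_binomial_prod: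
  "complex_fps (bounded_overpartition_fps N) * binomial_prod (- 1) N = binomial_prod 1 N"
proof (induction N)
  case 0
  then show ?case by (simp add: bounded_overpartition_fps_0 complex_fps_1 binomial_prod_def)
next
  case (Suc N)
  let ?Q = "\<lambda>N. complex_fps (bounded_overpartition_fps N)"
  have m: "1 + fps_const (- 1) * fps_X ^ Suc N = complex_fps (1 - fps_X ^ Suc N)"
    by (rule fps_ext) (simp del: power_Suc)
  have p: "1 + fps_const 1 * fps_X ^ Suc N = complex_fps (1 + fps_X ^ Suc N)"
    by (rule fps_ext) (simp del: power_Suc)
  have "?Q (Suc N) * binomial_prod (- 1) (Suc N) =
      complex_fps (bounded_overpartition_fps (Suc N) * (1 - fps_X ^ Suc N)) * binomial_prod (- 1) N"
    unfolding binomial_prod_Suc m complex_fps_mult by (simp add: algebra_simps)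
  also have "\<dots> = ?Q N * binomial_prod (- 1) N * complex_fps (1 + fps_X ^ Suc N)"
    unfolding bounded_overpartition_fps_Suc complex_fps_mult by (simp add: algebra_simps)
  also have "\<dots> = binomial_prod 1 (Suc N)"
    unfolding Suc binomial_prod_Suc p ..
  finally show ?case .
qed

text \<open>The quotient of the preceding product identity for c = 1 by that for c = -1. The common
  denominator \<open>?D\<close> has constant term 1 and can be cancelled.\<close>

lemma cubic_norm_bounded_overpartition_fps:
  "cubic_norm (complex_fps (bounded_overpartition_fps (3 * M))) *
     (complex_fps (bounded_overpartition_fps M) oo fps_X ^ 9) =
   (complex_fps (bounded_overpartition_fps (3 * M)) oo fps_X ^ 3) *
     (complex_fps (bounded_overpartition_fps M) oo fps_X ^ 3) ^ 3"
proof -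
  let ?Q = "\<lambda>N. complex_fps (bounded_overpartition_fps N)"
  let ?V = "binomial_prod (- 1)" and ?U = "binomial_prod 1"
  let ?D = "(?V (3 * M) oo fps_X ^ 3) * (?V M oo fps_X ^ 3) ^ 3"
  have V: "cubic_norm (?V (3 * M)) * (?V M oo fps_X ^ 9) = ?D"
    by (rule cubic_norm_binomial_prod) simp
  have U: "cubic_norm (?U (3 * M)) * (?U M oo fps_X ^ 9) =
      (?U (3 * M) oo fps_X ^ 3) * (?U M oo fps_X ^ 3) ^ 3"
    by (rule cubic_norm_binomial_prod) simp
  have "cubic_norm (?Q (3 * M)) * (?Q M oo fps_X ^ 9) * ?D =
      cubic_norm (?U (3 * M)) * (?U M oo fps_X ^ 9)"
    unfolding V[symmetric] bounded_overpartition_fps_mult_binomial_prod[symmetric]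
    by (simp add: cubic_norm_mult fps_compose_mult_distrib algebra_simps)
  also have "\<dots> = (?Q (3 * M) oo fps_X ^ 3) * (?Q M oo fps_X ^ 3) ^ 3 * ?D"
    unfolding U unfolding bounded_overpartition_fps_mult_binomial_prod[symmetric]
    by (simp add: fps_compose_mult_distrib power_mult_distrib algebra_simps)
  finally have "cubic_norm (?Q (3 * M)) * (?Q M oo fps_X ^ 9) * ?D =
      (?Q (3 * M) oo fps_X ^ 3) * (?Q M oo fps_X ^ 3) ^ 3 * ?D" .
  moreover have "?D \<noteq> 0"
  proof
    assume "?D = 0"
    then have "?D $ 0 = 0" by (simp only: fps_zero_nth)
    moreover have "?D $ 0 = 1"
      by (simp add: binomial_prod_nth_0 fps_power_zeroth)
    ultimately show False by (metis zero_neq_one)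
  qed
  ultimately show ?thesis by simp
qed

section \<open>Passage to the limit through congruence modulo q^(n+1)\<close>

definition agree_upto :: "nat \<Rightarrow> 'a :: comm_ring_1 fps \<Rightarrow> 'a fps \<Rightarrow> bool" where
  "agree_upto n f g \<longleftrightarrow> (\<forall>i\<le>n. f $ i = g $ i)"

lemma agree_upto_mult:
  "agree_upto n f f' \<Longrightarrow> agree_upto n g g' \<Longrightarrow> agree_upto n (f * g) (f' * g')"
  by (simp add: agree_upto_def fps_mult_nth)

lemma agree_upto_power: "agree_upto n f f' \<Longrightarrow> agree_upto n (f ^ k) (f' ^ k)"
  by (induction k) (simp_all add: agree_upto_mult, simp add: agree_upto_def)

lemma agree_upto_compose: "agree_upto n f f' \<Longrightarrow> agree_upto n (f oo g) (f' oo g)"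
  by (simp add: agree_upto_def fps_compose_nth)

text \<open>Up to exponent \<open>n\<close> the finite series at levels \<open>n\<close> and
  \<open>3 * n\<close> both agree with the full one, so the single factor and the cube merge into a
  fourth power.\<close>

lemma cubic_norm_overpartition_fps:
  "cubic_norm (complex_fps overpartition_fps) * (complex_fps overpartition_fps oo fps_X ^ 9) =
   (complex_fps overpartition_fps oo fps_X ^ 3) ^ 4"
proof (rule fps_ext)
  fix n
  let ?G = "complex_fps overpartition_fps"
  let ?Q = "\<lambda>N. complex_fps (bounded_overpartition_fps N)"
  have agree: "agree_upto n ?G (?Q N)" if "n \<le> N" for N
    unfolding agree_upto_def using that overpartition_fps_nth[of _ N] by simp
  have "agree_upto n (cubic_norm ?G * (?G oo fps_X ^ 9)) (cubic_norm (?Q (3 * n)) * (?Q n oo fps_X ^ 9))"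
    unfolding cubic_norm_def twist_def
    by (intro agree_upto_mult agree_upto_compose agree) auto
  moreover have "agree_upto n ((?G oo fps_X ^ 3) * (?G oo fps_X ^ 3) ^ 3)
      ((?Q (3 * n) oo fps_X ^ 3) * (?Q n oo fps_X ^ 3) ^ 3)"
    by (intro agree_upto_mult agree_upto_power agree_upto_compose agree) auto
  moreover have "(?G oo fps_X ^ 3) * (?G oo fps_X ^ 3) ^ 3 = (?G oo fps_X ^ 3) ^ 4"
    by (simp add: eval_nat_numeral)
  ultimately show "(cubic_norm ?G * (?G oo fps_X ^ 9)) $ n = ((?G oo fps_X ^ 3) ^ 4) $ n"
    using cubic_norm_bounded_overpartition_fps[of n] by (simp add: agree_upto_def)
qed

section \<open>Theta coefficients by residue modulo 3\<close>

lemma square_mod_3: "(m :: nat)\<^sup>2 mod 3 \<noteq> 2" "3 dvd m\<^sup>2 \<Longrightarrow> 3 dvd m"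
proof -
  have "m mod 3 = 0 \<or> m mod 3 = 1 \<or> m mod 3 = 2" by presburger
  moreover have "m\<^sup>2 mod 3 = (m mod 3)\<^sup>2 mod 3" by (simp add: power_mod)
  ultimately have "m mod 3 = 0 \<and> m\<^sup>2 mod 3 = 0 \<or> m\<^sup>2 mod 3 = 1" by auto
  then show "m\<^sup>2 mod 3 \<noteq> 2" "3 dvd m\<^sup>2 \<Longrightarrow> 3 dvd m" by auto
qed

lemma theta_coeff_mod_3_eq_2: "n mod 3 = 2 \<Longrightarrow> theta_coeff n = 0"
  by (rule theta_coeff_nonsquare) (use square_mod_3(1) in blast)

text \<open>A square divisible by 3 has the form 9j^2, and (-1)^(3j) = (-1)^j keeps the sign. Hence
  the terms of theta with exponent divisible by 3 make up theta(q^9).\<close>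

lemma theta_coeff_dvd_3:
  assumes "3 dvd n"
  shows "theta_coeff n = (if 9 dvd n then theta_coeff (n div 9) else 0)"
proof (cases "\<exists>m. n = m\<^sup>2")
  case True
  then obtain m where m: "n = m\<^sup>2" by blast
  then obtain j where j: "m = 3 * j"
    using assms square_mod_3(2)[of m] by blast
  then have n: "n = 9 * j\<^sup>2" by (simp add: m power_mult_distrib)
  show ?thesis
  proof (cases "j = 0")
    case False
    then have "theta_coeff n = 2 * (-1) ^ (3 * j)"
      using m j theta_coeff_square[of m] by simp
    also have "\<dots> = 2 * (-1) ^ j"
      by (simp add: power_mult)
    finally show ?thesis
      using n False theta_coeff_square[of j] by simp
  qed (simp add: n theta_coeff_0)
next
  case False
  have "theta_coeff (n div 9) = 0" if "9 dvd n"
  proof (rule theta_coeff_nonsquare)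
    fix m
    show "n div 9 \<noteq> m\<^sup>2"
    proof
      assume "n div 9 = m\<^sup>2"
      then have "n = (3 * m)\<^sup>2" using that by (auto simp: power_mult_distrib)
      then show False using False by blast
    qed
  qed
  moreover have "theta_coeff n = 0"
    by (rule theta_coeff_nonsquare) (use False in blast)
  ultimately show ?thesis by simp
qed

lemma trisection_overpartition_fps:
  "trisection overpartition_fps = overpartition_fps ^ 4 * (theta_fps oo fps_X ^ 3) ^ 3"
proof -
  let ?G = "complex_fps overpartition_fps" and ?F = "complex_fps theta_fps"
  \<comment> \<open>\<open>f\<close> is chosen so that \<open>a\<close> is \<open>f\<close> at q^3;
    multiplying by \<open>a\<close> then commutes with trisection, up to replacing \<open>a\<close>
    by \<open>f\<close>.\<close>
  define f where "f = ?F oo fps_X ^ 3"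
  define a where "a = ?F oo fps_X ^ 9"
  define b where "b = ?F - a"
  have FG: "?F * ?G = 1"
    by (simp add: complex_fps_mult[symmetric] theta_fps_mult_overpartition_fps complex_fps_1)
  have a: "a = f oo fps_X ^ 3"
    by (simp add: a_def f_def fps_compose_X_power_X_power)
  have a_nth: "a $ n = (if 9 dvd n then of_int (theta_coeff (n div 9)) else 0)" for n
    by (simp add: a_def fps_compose_X_power_nth theta_fps_def)
  have a_nz: "a $ n = 0" if "n mod 3 \<noteq> 0" for n
  proof -
    have "\<not> 9 dvd n" using that by presburger
    then show ?thesis by (simp add: a_nth)
  qed
  have b_nth: "b $ n = 0" if "n mod 3 \<noteq> 1" for n
  proof -
    have "n mod 3 = 0 \<or> n mod 3 = 2" using that by presburger
    then show ?thesis
    proof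
      assume "n mod 3 = 0"
      then have "3 dvd n" by auto
      then show ?thesis
        using theta_coeff_dvd_3[of n] by (simp add: b_def a_nth theta_fps_def)
    next
      assume "n mod 3 = 2"
      then show ?thesis
        using theta_coeff_mod_3_eq_2[of n] a_nz[of n] by (simp add: b_def theta_fps_def)
    qed
  qed
  \<comment> \<open>Exponents in \<open>a\<close> are 0 and those in \<open>b\<close> are 1 modulo
    3, so the substitution q to wq multiplies only \<open>b\<close> by w.\<close>
  have tw: "twist w ?F = a + fps_const w * b" if "w ^ 3 = 1" for w
  proof (rule fps_ext)
    fix n
    have w: "w ^ n = w ^ (n mod 3)"
    proof -
      have "w ^ n = w ^ (3 * (n div 3) + n mod 3)" by simp
      then show ?thesis by (simp only: power_add power_mult that) simp
    qed
    have F: "?F $ n = a $ n + b $ n" by (simp add: b_def)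
    have "n mod 3 = 0 \<or> n mod 3 = 1 \<or> n mod 3 = 2" by presburger
    then show "twist w ?F $ n = (a + fps_const w * b) $ n"
      unfolding twist_nth F w by (elim disjE) (simp_all add: a_nz b_nth)
  qed
  have w3: "(\<omega>\<^sup>2) ^ 3 = 1"
    using omega_power_mod[of 6] by (simp add: power_mult[symmetric])
  have conj: "twist \<omega> ?F * twist (\<omega>\<^sup>2) ?F = a * a - a * b + b * b"
  proof -
    have "twist \<omega> ?F * twist (\<omega>\<^sup>2) ?F =
        a * a + fps_const (\<omega> + \<omega>\<^sup>2) * (a * b) + fps_const (\<omega> * \<omega>\<^sup>2) * (b * b)"
      unfolding tw[OF omega_cube] tw[OF w3]
      by (simp add: algebra_simps flip: fps_const_add fps_const_mult)
    moreover have "fps_const (- 1) = (- 1 :: complex fps)"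
      by (rule fps_ext) simp
    ultimately show ?thesis by (simp add: omega_sum omega_prod)
  qed
  \<comment> \<open>The norm identity solved for \<open>?G\<close>: each twist of \<open>?F\<close>
    is inverse to the same twist of \<open>?G\<close>, and \<open>a\<close> is inverse to
    \<open>?G\<close> at q^9.\<close>
  have G: "?G = ((?G ^ 4 * f) oo fps_X ^ 3) * (twist \<omega> ?F * twist (\<omega>\<^sup>2) ?F)"
  proof -
    have tw1: "twist w ?F * twist w ?G = 1" for w
      by (simp add: twist_mult[symmetric] FG twist_1)
    have "a * (?G oo fps_X ^ 9) = (?F * ?G) oo fps_X ^ 9"
      unfolding a_def by (rule fps_compose_mult_distrib[symmetric]) simp
    then have a1: "a * (?G oo fps_X ^ 9) = 1"
      by (simp add: FG)
    have "((?G ^ 4 * f) oo fps_X ^ 3) * (twist \<omega> ?F * twist (\<omega>\<^sup>2) ?F) =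
        (?G oo fps_X ^ 3) ^ 4 * a * (twist \<omega> ?F * twist (\<omega>\<^sup>2) ?F)"
      by (simp add: fps_compose_mult_distrib fps_compose_power a)
    also have "\<dots> = ?G * (twist \<omega> ?F * twist \<omega> ?G) * (twist (\<omega>\<^sup>2) ?F * twist (\<omega>\<^sup>2) ?G) *
        (a * (?G oo fps_X ^ 9))"
      unfolding cubic_norm_overpartition_fps[symmetric] cubic_norm_def by (simp only: ac_simps)
    also have "\<dots> = ?G"
      unfolding tw1 a1 by simp
    finally show ?thesis ..
  qed
  have "trisection (a * a - a * b + b * b) = trisection (a * a) - trisection (a * b) + trisection (b * b)"
    by (rule fps_ext) (simp add: trisection_nth)
  moreover have "trisection (a * a) = f * f"
  proof -
    have "trisection a = f * trisection 1"
      using trisection_mult[of f 1] by (simp add: a)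
    moreover have "trisection (1 :: complex fps) = 1"
      by (rule fps_ext) (simp add: trisection_nth)
    ultimately show ?thesis
      using trisection_mult[of f a] by (simp add: a)
  qed
  moreover have "trisection (a * b) = 0"
  proof -
    have "trisection b = 0"
      by (rule fps_ext) (simp add: trisection_nth b_nth)
    then show ?thesis
      using trisection_mult[of f b] by (simp add: a)
  qed
  moreover have "trisection (b * b) = 0"
  proof (rule fps_ext)
    fix n
    have "b $ i * b $ (3 * n - i) = 0" if "i \<le> 3 * n" for i
    proof -
      \<comment> \<open>Two exponents from \<open>b\<close> add up to 2 modulo 3, never to a
        multiple of 3.\<close>
      have "(i mod 3 + (3 * n - i) mod 3) mod 3 = 0"
        unfolding mod_add_eq using that by simp
      then have "i mod 3 \<noteq> 1 \<or> (3 * n - i) mod 3 \<noteq> 1"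
        by (auto dest: dvd_imp_le)
      then show ?thesis using b_nth by auto
    qed
    then show "trisection (b * b) $ n = 0 $ n"
      unfolding trisection_nth fps_mult_nth fps_zero_nth by (intro sum.neutral) auto
  qed
  ultimately have "trisection ?G = ?G ^ 4 * f * (f * f)"
    by (subst G) (simp add: trisection_mult conj)
  then have "trisection ?G = ?G ^ 4 * f ^ 3"
    by (simp only: power3_eq_cube mult.assoc)
  then have "complex_fps (trisection overpartition_fps) =
      complex_fps (overpartition_fps ^ 4 * (theta_fps oo fps_X ^ 3) ^ 3)"
    by (simp add: complex_fps_trisection complex_fps_mult complex_fps_power
        complex_fps_compose_X_power f_def)
  then show ?thesis by (simp add: complex_fps_eq_iff)
qed

section \<open>Reduction modulo 9\<close>

lemma int_cube_minus_self_dvd_3: "(3 :: int) dvd c ^ 3 - c"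
proof -
  have "c mod 3 = 0 \<or> c mod 3 = 1 \<or> c mod 3 = 2" by presburger
  moreover have "(c ^ 3 - c) mod 3 = ((c mod 3) ^ 3 - c mod 3) mod 3"
    by (rule mod_diff_cong) (simp_all add: power_mod)
  ultimately have "(c ^ 3 - c) mod 3 = 0"
    by (elim disjE) (simp_all only:, simp_all)
  then show ?thesis by (rule mod_0_imp_dvd)
qed

text \<open>The Frobenius congruence. After splitting off the constant term c, the mixed terms of
  the cube carry a factor 3 and c^3 is congruent to c. What remains is the same difference for the
  shifted series, three places lower; hence strong induction with \<open>f\<close>
  arbitrary.\<close>

lemma fps_cube_cong_mod_3: "(3 :: int) dvd ((f oo fps_X ^ 3) - f ^ 3) $ n"
proof (induction n arbitrary: f rule: less_induct)
  case (less n)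
  define c where "c = f $ 0"
  define g where "g = fps_shift 1 f"
  have f: "f = fps_const c + fps_X * g"
    by (rule fps_ext) (simp add: c_def g_def)
  have "f oo fps_X ^ 3 = fps_const c + fps_X ^ 3 * (g oo fps_X ^ 3)"
    by (subst f) (simp add: fps_compose_add_distrib fps_compose_mult_distrib)
  moreover have "f ^ 3 = fps_const (c ^ 3) +
      fps_const 3 * (fps_const (c\<^sup>2) * fps_X * g + fps_const c * fps_X\<^sup>2 * g\<^sup>2) + fps_X ^ 3 * g ^ 3"
    unfolding f
    by (simp add: power2_eq_square power3_eq_cube algebra_simps fps_numeral_fps_const[symmetric]
        flip: fps_const_mult)
  ultimately have "(f oo fps_X ^ 3) - f ^ 3 = fps_const (c - c ^ 3) -
      fps_const 3 * (fps_const (c\<^sup>2) * fps_X * g + fps_const c * fps_X\<^sup>2 * g\<^sup>2) +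
      fps_X ^ 3 * ((g oo fps_X ^ 3) - g ^ 3)"
    by (simp add: algebra_simps flip: fps_const_sub)
  then have "((f oo fps_X ^ 3) - f ^ 3) $ n = (if n = 0 then c - c ^ 3 else 0) -
      3 * (fps_const (c\<^sup>2) * fps_X * g + fps_const c * fps_X\<^sup>2 * g\<^sup>2) $ n +
      (if n < 3 then 0 else ((g oo fps_X ^ 3) - g ^ 3) $ (n - 3))"
    by (simp only: fps_add_nth fps_sub_nth fps_mult_left_const_nth fps_X_power_mult_nth fps_nth_fps_const)
  moreover have "3 dvd (if n = 0 then c - c ^ 3 else 0)"
    using int_cube_minus_self_dvd_3[of c] by (simp add: dvd_diff_commute)
  moreover have "3 dvd (if n < 3 then 0 else ((g oo fps_X ^ 3) - g ^ 3) $ (n - 3))"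
    using less[of "n - 3" g] by auto
  ultimately show ?case by (metis dvd_add dvd_diff dvd_triv_left)
qed

text \<open>An explicit cofactor \<open>K\<close> allows the relation modulo 3 to be cubed into one
  modulo 9.\<close>

lemma fps_cube_eq_mod_3:
  obtains K where "(f :: int fps) oo fps_X ^ 3 = f ^ 3 + 3 * K"
proof
  show "f oo fps_X ^ 3 = f ^ 3 + 3 * Abs_fps (\<lambda>n. ((f oo fps_X ^ 3) - f ^ 3) $ n div 3)"
  proof (rule fps_ext)
    fix n
    show "(f oo fps_X ^ 3) $ n =
        (f ^ 3 + 3 * Abs_fps (\<lambda>n. ((f oo fps_X ^ 3) - f ^ 3) $ n div 3)) $ n"
      using fps_cube_cong_mod_3[of f n]
      by (simp add: fps_numeral_fps_const)
  qed
qed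

theorem theorem5:
  fixes n :: nat
  assumes "n \<ge> 1"
  shows "int (overpartition_count (3 * n)) mod 9 = ((-1) ^ n * int (r_sq 5 n)) mod 9"
proof -
  let ?F = theta_fps and ?G = overpartition_fps
  obtain K where K: "?F oo fps_X ^ 3 = ?F ^ 3 + 3 * K"
    by (rule fps_cube_eq_mod_3)
  define L where "L = ?G ^ 4 * (?F ^ 6 * K + 3 * ?F ^ 3 * K\<^sup>2 + 3 * K ^ 3)"
  \<comment> \<open>In the binomial expansion all terms involving \<open>K\<close> have coefficient
    9 or 27. The power \<open>?F ^ 9\<close> is split so that \<open>?F ^ 4\<close> cancels against
    \<open>?G ^ 4\<close> in the trisection formula.\<close>
  have "(?F ^ 3 + 3 * K) ^ 3 = ?F ^ 4 * ?F ^ 5 + 9 * (?F ^ 6 * K + 3 * ?F ^ 3 * K\<^sup>2 + 3 * K ^ 3)"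
    by (simp add: eval_nat_numeral algebra_simps)
  then have "trisection ?G = (?F * ?G) ^ 4 * ?F ^ 5 + 9 * L"
    by (simp add: trisection_overpartition_fps K L_def algebra_simps power_mult_distrib)
  then have "trisection ?G = ?F ^ 5 + fps_const 9 * L"
    by (simp add: theta_fps_mult_overpartition_fps fps_numeral_fps_const)
  then have "trisection ?G $ n = (?F ^ 5) $ n + 9 * L $ n"
    by (simp only: fps_add_nth fps_mult_left_const_nth)
  then have "int (overpartition_count (3 * n)) = (-1) ^ n * int (r_sq 5 n) + 9 * L $ n"
    by (simp add: trisection_nth theta_fps_power_nth overpartition_fps_def)
  then show ?thesis by simp
qed

end
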